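(* Let $\varphi$ be a Ma-Minda function with $\varphi(z)=1+B_1z+B_2z^2+B_3z^3+\cdots$, and let $f\in\mathcal{S}^*(\varphi)$. Put $$\sigma_1=-\frac{9B_1^2-4B_2}{2B_1},\qquad \mu_1=\frac{9B_1^3-9B_1B_2+2B_3}{2B_1}.$$ If $|B_2-2B_1^2|\ge B_1$ and $(\sigma_1,\mu_1)\in\Omega_1\cup\Omega_2\cup\Omega_3$, then $$|T_{2,2}(F_{f^{-1}})|=|\Gamma_2^2-\Gamma_3^2|\le\frac{(B_2-2B_1^2)^2}{16}+\frac{(9B_1^3-9B_1B_2+2B_3)^2}{144}.$$ The bound is sharp (for each such $\varphi$, equality is attained by some $f\in\mathcal{S}^*(\varphi)$).
   Context: $\mathbb{U}=\{z\in\mathbb{C}:|z|<1\}$, and $\mathcal{A}$ is the class of analytic functions $f$ on $\mathbb{U}$ of the form $f(z)=z+\sum_{n\ge2}a_nz^n$. For analytic $g,h$ on $\mathbb{U}$, $g\prec h$ (subordination) means there is an analytic $\omega:\mathbb{U}\to\mathbb{C}$ with $\omega(0)=0$, $|\omega(z)|\le1$, and $g=h\circ\omega$. A Ma-Minda function is an analytic univalent $\varphi$ on $\mathbb{U}$ with $\varphi(0)=1$, $\varphi'(0)>0$, mapping $\mathbb{U}$ onto a domain in the right half-plane that is symmetric about the real axis and starlike with respect to $\varphi(0)=1$ (so $B_1>0$ and all $B_n$ are real). $\mathcal{S}^*(\varphi)=\{f\in\mathcal{A}: zf'(z)/f(z)\prec\varphi(z)\}$; its members are univalent. The local inverse $f^{-1}$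 near $0$ has the logarithmic coefficients $\Gamma_n$ defined by $F_{f^{-1}}(w)=\log\big(f^{-1}(w)/w\big)=2\sum_{n\ge1}\Gamma_nw^n$ (with $\log 1=0$). Equivalently $\Gamma_2=-\tfrac12(a_3-\tfrac32a_2^2)$, $\Gamma_3=-\tfrac12(a_4-4a_2a_3+\tfrac{10}{3}a_2^3)$. Definition: $T_{2,2}(F_{f^{-1}})=\Gamma_2^2-\Gamma_3^2$. Regions in $\mathbb{R}^2$: $\Omega_1=\{(\sigma,\mu):|\sigma|\le2,\ \mu\ge1\}$, $\Omega_2=\{(\sigma,\mu):2\le|\sigma|\le4,\ \mu\ge\frac1{12}(\sigma^2+8)\}$, $\Omega_3=\{(\sigma,\mu):|\sigma|\ge4,\ \mu\ge\frac23(|\sigma|-1)\}$. *)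

theory Defs
  imports "HOL-Complex_Analysis.Complex_Analysis"
begin

abbreviation unit_disc :: "complex set" where
  "unit_disc \<equiv> ball 0 1"

definition taylor_coeff :: "(complex \<Rightarrow> complex) \<Rightarrow> nat \<Rightarrow> complex" where
  "taylor_coeff f n = fps_nth (fps_expansion f 0) n"

definition class_A :: "(complex \<Rightarrow> complex) set" where
  "class_A = {f. f holomorphic_on unit_disc \<and> f 0 = 0 \<and> deriv f 0 = 1}"

text \<open>
  A function \<open>\<omega>\<close> as below satisfies \<open>cmod (\<omega> z) < 1\<close> on the disc by the maximum modulus principle,
  so values of \<open>h\<close> outside the disc are never used.
\<close>

definition subordinate :: "(complex \<Rightarrow> complex) \<Rightarrow> (complex \<Rightarrow> complex) \<Rightarrow> bool"
  (infix \<open>\<prec>\<^sub>s\<close> 50) where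
  "g \<prec>\<^sub>s h \<longleftrightarrow> g holomorphic_on unit_disc \<and> h holomorphic_on unit_disc \<and>
     (\<exists>\<omega>. \<omega> holomorphic_on unit_disc \<and> \<omega> 0 = 0 \<and>
        (\<forall>z\<in>unit_disc. cmod (\<omega> z) \<le> 1) \<and> (\<forall>z\<in>unit_disc. g z = h (\<omega> z)))"

definition ma_minda :: "(complex \<Rightarrow> complex) \<Rightarrow> bool" where
  "ma_minda \<phi> \<longleftrightarrow> \<phi> holomorphic_on unit_disc \<and> inj_on \<phi> unit_disc \<and>
     \<phi> 0 = 1 \<and> deriv \<phi> 0 \<in> \<real> \<and> Re (deriv \<phi> 0) > 0 \<and>
     (\<forall>w\<in>\<phi> ` unit_disc. Re w > 0) \<and>
     cnj ` (\<phi> ` unit_disc) = \<phi> ` unit_disc \<and>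
     (\<forall>w\<in>\<phi> ` unit_disc. closed_segment 1 w \<subseteq> \<phi> ` unit_disc)"

text \<open>
  The Taylor coefficients of a Ma-Minda function are real, see \<open>ma_minda_coeff_real\<close> below;
  taking real parts only turns them into elements of type \<open>real\<close>.
\<close>

definition mm_coeff :: "(complex \<Rightarrow> complex) \<Rightarrow> nat \<Rightarrow> real" where
  "mm_coeff \<phi> n = Re (taylor_coeff \<phi> n)"

text \<open>
  The quotient \<open>z f'(z) / f(z)\<close> has a removable singularity at \<open>0\<close>, with value \<open>1\<close> for \<open>f\<close> in
  \<^const>\<open>class_A\<close>. If \<open>f\<close> had another zero in the disc, the totalised quotient would be \<open>0\<close> there,
  which is not a value of a Ma-Minda function, so \<open>f\<close> would not belong to the class below.
\<close>

definition starlike_quotient :: "(complex \<Rightarrow> complex) \<Rightarrow> complex \<Rightarrow> complex" where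
  "starlike_quotient f z = (if z = 0 then 1 else z * deriv f z / f z)"

definition starlike_class :: "(complex \<Rightarrow> complex) \<Rightarrow> (complex \<Rightarrow> complex) set" where
  "starlike_class \<phi> = {f \<in> class_A. starlike_quotient f \<prec>\<^sub>s \<phi>}"

definition is_local_inverse :: "(complex \<Rightarrow> complex) \<Rightarrow> (complex \<Rightarrow> complex) \<Rightarrow> bool" where
  "is_local_inverse f g \<longleftrightarrow>
     g analytic_on {0} \<and> g 0 = 0 \<and> (\<forall>\<^sub>F w in nhds 0. f (g w) = w)"

text \<open>
  For \<open>f\<close> in \<^const>\<open>class_A\<close> a local inverse exists and its germ at \<open>0\<close> is unique
  (\<open>is_local_inverse_exists\<close> and \<open>is_local_inverse_unique\<close> below). Only this germ enters the
  coefficients \<open>log_inv_coeff\<close>, which therefore do not depend on the choice made here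
  (\<open>log_inv_coeff_eq\<close>).
\<close>

definition local_inverse :: "(complex \<Rightarrow> complex) \<Rightarrow> complex \<Rightarrow> complex" where
  "local_inverse f = (SOME g. is_local_inverse f g)"

text \<open>
  Here \<open>g w / w\<close> tends to \<open>1\<close> as \<open>w\<close> tends to \<open>0\<close>, so that near \<open>0\<close> the principal branch is the
  analytic branch with \<open>log 1 = 0\<close>, the value at \<open>w = 0\<close> being the limit.
\<close>

definition log_inverse :: "(complex \<Rightarrow> complex) \<Rightarrow> complex \<Rightarrow> complex" where
  "log_inverse f w = (if w = 0 then 0 else Ln (local_inverse f w / w))"

definition log_inv_coeff :: "(complex \<Rightarrow> complex) \<Rightarrow> nat \<Rightarrow> complex" where
  "log_inv_coeff f n = taylor_coeff (log_inverse f) n / 2"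

definition toeplitz_log_inv_2_2 :: "(complex \<Rightarrow> complex) \<Rightarrow> complex" where
  "toeplitz_log_inv_2_2 f = (log_inv_coeff f 2)\<^sup>2 - (log_inv_coeff f 3)\<^sup>2"

definition Omega1 :: "(real \<times> real) set" where
  "Omega1 = {(\<sigma>, \<mu>). \<bar>\<sigma>\<bar> \<le> 2 \<and> \<mu> \<ge> 1}"

definition Omega2 :: "(real \<times> real) set" where
  "Omega2 = {(\<sigma>, \<mu>). 2 \<le> \<bar>\<sigma>\<bar> \<and> \<bar>\<sigma>\<bar> \<le> 4 \<and> \<mu> \<ge> (1/12) * (\<sigma>\<^sup>2 + 8)}"

definition Omega3 :: "(real \<times> real) set" where
  "Omega3 = {(\<sigma>, \<mu>). \<bar>\<sigma>\<bar> \<ge> 4 \<and> \<mu> \<ge> (2/3) * (\<bar>\<sigma>\<bar> - 1)}"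

lemma is_local_inverse_exists:
  assumes "f \<in> class_A"
  shows "\<exists>g. is_local_inverse f g"
proof -
  have f: "f holomorphic_on unit_disc" "f 0 = 0" "deriv f 0 \<noteq> 0"
    using assms by (auto simp: class_A_def)
  obtain r where r: "r > 0" "ball 0 r \<subseteq> unit_disc" "inj_on f (ball 0 r)"
    by (rule has_complex_derivative_locally_injective[OF f(1) centre_in_ball[THEN iffD2] open_ball f(3)])
      simp
  have hol: "f holomorphic_on ball 0 r"
    using f(1) r(2) by (rule holomorphic_on_subset)
  obtain g where g: "g holomorphic_on (f ` ball 0 r)"
     "\<And>z. z \<in> ball 0 r \<Longrightarrow> deriv f z * deriv g (f z) = 1"
     "\<And>z. z \<in> ball 0 r \<Longrightarrow> g (f z) = z"
    by (rule holomorphic_has_inverse[OF hol open_ball r(3)]) (rule that)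
  have op: "open (f ` ball 0 r)"
    by (rule open_mapping_thm3[OF hol open_ball r(3)])
  have mem: "0 \<in> f ` ball 0 r"
    using r(1) by (intro image_eqI[of _ f 0]) (simp_all add: f(2))
  have "g analytic_on {0}"
    using g(1) op mem analytic_at by blast
  moreover have "g 0 = 0"
    using g(3)[of 0] f(2) r(1) by simp
  moreover have "\<forall>\<^sub>F w in nhds 0. f (g w) = w"
    using eventually_nhds_in_open[OF op mem] by eventually_elim (auto simp: g(3))
  ultimately show ?thesis
    unfolding is_local_inverse_def by blast
qed

lemma is_local_inverse_unique:
  assumes "f \<in> class_A" "is_local_inverse f g" "is_local_inverse f h"
  shows "\<forall>\<^sub>F w in nhds 0. g w = h w"
proof -
  have f: "f holomorphic_on unit_disc" "deriv f 0 \<noteq> 0"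
    using assms by (auto simp: class_A_def)
  obtain r where r: "r > 0" "inj_on f (ball 0 r)"
    by (rule has_complex_derivative_locally_injective[OF f(1) centre_in_ball[THEN iffD2] open_ball f(2)])
      simp
  have ball: "\<forall>\<^sub>F w in nhds 0. k w \<in> ball 0 r" if "is_local_inverse f k" for k
  proof -
    have "k analytic_on {0}" "k 0 = 0"
      using that by (auto simp: is_local_inverse_def)
    then have "isCont k 0"
      by (simp add: analytic_at_imp_isCont)
    then have "(k \<longlongrightarrow> 0) (nhds 0)"
      using \<open>k 0 = 0\<close> by (simp add: continuous_at tendsto_nhds_iff)
    then show ?thesis
      by (rule topological_tendstoD) (use r in auto)
  qed
  have "\<forall>\<^sub>F w in nhds 0. f (g w) = w" "\<forall>\<^sub>F w in nhds 0. f (h w) = w"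
    using assms by (auto simp: is_local_inverse_def)
  then show ?thesis
    using ball[OF assms(2)] ball[OF assms(3)]
    by eventually_elim (rule inj_onD[OF r(2)], simp_all)
qed

lemma log_inv_coeff_eq:
  assumes "f \<in> class_A" "is_local_inverse f g"
  shows "log_inv_coeff f n = taylor_coeff (\<lambda>w. if w = 0 then 0 else Ln (g w / w)) n / 2"
proof -
  have "is_local_inverse f (local_inverse f)"
    unfolding local_inverse_def using assms(2) by (rule someI[where P = "is_local_inverse f"])
  then have "\<forall>\<^sub>F w in nhds 0. local_inverse f w = g w"
    using is_local_inverse_unique[OF assms(1) _ assms(2)] by blast
  then have "\<forall>\<^sub>F w in nhds 0. log_inverse f w = (if w = 0 then 0 else Ln (g w / w))"
    by eventually_elim (simp add: log_inverse_def)
  then have "fps_expansion (log_inverse f) 0 =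
      fps_expansion (\<lambda>w. if w = 0 then 0 else Ln (g w / w)) 0"
    by (rule fps_expansion_cong)
  then show ?thesis
    by (simp add: log_inv_coeff_def taylor_coeff_def)
qed

lemma ma_minda_symmetric:
  assumes "ma_minda \<phi>" "z \<in> unit_disc"
  shows "cnj (\<phi> (cnj z)) = \<phi> z"
proof -
  have \<phi>: "\<phi> holomorphic_on unit_disc" "inj_on \<phi> unit_disc" "\<phi> 0 = 1" "deriv \<phi> 0 \<in> \<real>"
     "deriv \<phi> 0 \<noteq> 0" "cnj ` (\<phi> ` unit_disc) = \<phi> ` unit_disc"
    using assms(1) by (auto simp: ma_minda_def)
  obtain \<psi> where \<psi>: "\<psi> holomorphic_on (\<phi> ` unit_disc)"
     "\<And>z. z \<in> unit_disc \<Longrightarrow> deriv \<phi> z * deriv \<psi> (\<phi> z) = 1"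
     "\<And>z. z \<in> unit_disc \<Longrightarrow> \<psi> (\<phi> z) = z"
    by (rule holomorphic_has_inverse[OF \<phi>(1) open_ball \<phi>(2)]) (rule that)
  define g where "g = cnj \<circ> \<phi> \<circ> cnj"
  have disc: "cnj ` unit_disc = unit_disc"
    by (rule set_eqI) (simp add: in_image_cnj_iff)
  have g: "g holomorphic_on unit_disc"
    unfolding g_def using \<phi>(1) disc by (intro holomorphic_on_compose_cnj_cnj) auto
  have img: "g ` unit_disc = \<phi> ` unit_disc"
    unfolding g_def image_comp[symmetric] disc \<phi>(6) ..
  have "(\<phi> has_field_derivative deriv \<phi> 0) (at 0)"
    using \<phi>(1) by (meson centre_in_ball holomorphic_derivI open_ball zero_less_one)
  then have dg: "(g has_field_derivative deriv \<phi> 0) (at 0)"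
    unfolding g_def using has_field_derivative_cnj_cnj[of \<phi> "deriv \<phi> 0" 0] \<phi>(4)
    by (simp add: Reals_cnj_iff o_assoc)
  have op: "open (\<phi> ` unit_disc)"
    by (rule open_mapping_thm3[OF \<phi>(1) open_ball \<phi>(2)])
  have g0: "g 0 = 1"
    using \<phi>(3) by (simp add: g_def)
  have one: "1 \<in> \<phi> ` unit_disc"
    by (intro image_eqI[of _ \<phi> 0]) (simp_all add: \<phi>(3))
  have "(\<psi> has_field_derivative deriv \<psi> 1) (at 1)"
    using \<psi>(1) op one by (rule holomorphic_derivI)
  then have "((\<psi> \<circ> g) has_field_derivative (deriv \<psi> 1 * deriv \<phi> 0)) (at 0)"
    using DERIV_chain[of \<psi> "deriv \<psi> 1" g 0 "deriv \<phi> 0" UNIV] dg g0 by simp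
  moreover have "deriv \<psi> 1 * deriv \<phi> 0 = 1"
    using \<psi>(2)[of 0] \<phi>(3) by (simp add: mult.commute)
  ultimately have d: "deriv (\<psi> \<circ> g) 0 = 1"
    using DERIV_imp_deriv by fastforce
  have hol: "(\<psi> \<circ> g) holomorphic_on unit_disc"
    using g \<psi>(1) img by (intro holomorphic_on_compose) auto
  have zero: "(\<psi> \<circ> g) 0 = 0"
    using g0 \<psi>(3)[of 0] \<phi>(3) by simp
  have maps: "cmod ((\<psi> \<circ> g) w) < 1" if "cmod w < 1" for w
  proof -
    have "g w \<in> \<phi> ` unit_disc"
      using that img by (metis image_eqI mem_ball_0)
    then show ?thesis
      using \<psi>(3) by auto
  qed
  obtain \<alpha> where \<alpha>: "\<And>z. cmod z < 1 \<Longrightarrow> (\<psi> \<circ> g) z = \<alpha> * z"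
    using Schwarz_Lemma(3)[OF hol zero maps, of 0] d
    by (metis norm_one norm_zero zero_less_one)
  have "((\<lambda>z. \<alpha> * z) has_field_derivative \<alpha>) (at 0)"
    by (auto intro!: derivative_eq_intros)
  moreover have "deriv (\<psi> \<circ> g) 0 = deriv (\<lambda>z. \<alpha> * z) 0"
    using eventually_nhds_in_open[of unit_disc 0]
    by (intro deriv_cong_ev) (auto elim!: eventually_mono simp: \<alpha> simp del: o_apply)
  ultimately have "\<alpha> = 1"
    using d DERIV_imp_deriv by metis
  have z: "cmod z < 1"
    using assms(2) by simp
  obtain y where y: "y \<in> unit_disc" "g z = \<phi> y"
    using img assms(2) by blast
  have "y = z"
    using \<alpha>[OF z] \<psi>(3)[OF y(1)] y(2) \<open>\<alpha> = 1\<close> by simp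
  then show ?thesis
    using y(2) by (simp add: g_def)
qed

lemma ma_minda_coeff_real:
  assumes "ma_minda \<phi>"
  shows "taylor_coeff \<phi> n = complex_of_real (mm_coeff \<phi> n)"
proof -
  have hol: "\<phi> holomorphic_on unit_disc"
    using assms by (simp add: ma_minda_def)
  have real: "(deriv ^^ n) \<phi> z = cnj ((deriv ^^ n) \<phi> (cnj z))" if "z \<in> unit_disc" for z
    using that
  proof (induction n arbitrary: z)
    case 0
    then show ?case
      using ma_minda_symmetric[OF assms, of z] by simp
  next
    case (Suc n)
    let ?D = "(deriv ^^ n) \<phi>"
    have "?D holomorphic_on unit_disc"
      using hol by (intro holomorphic_higher_deriv) auto
    then have "(?D has_field_derivative deriv ?D (cnj z)) (at (cnj z))"
      using Suc.prems by (intro holomorphic_derivI[of _ unit_disc]) auto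
    then have "((cnj \<circ> ?D \<circ> cnj) has_field_derivative cnj (deriv ?D (cnj z))) (at z)"
      using has_field_derivative_cnj_cnj[of ?D "deriv ?D (cnj z)" z]
      by (simp add: o_assoc)
    then have "deriv (cnj \<circ> ?D \<circ> cnj) z = cnj (deriv ?D (cnj z))"
      by (rule DERIV_imp_deriv)
    moreover have "deriv ?D z = deriv (cnj \<circ> ?D \<circ> cnj) z"
      using eventually_nhds_in_open[of unit_disc z] Suc
      by (intro deriv_cong_ev) (auto elim!: eventually_mono)
    ultimately show ?case
      by simp
  qed
  have "(deriv ^^ n) \<phi> 0 \<in> \<real>"
    using real[of 0] by (simp add: Reals_cnj_iff)
  moreover have "(fact n :: complex) \<in> \<real>"
    by (metis Reals_of_nat of_nat_fact)
  ultimately have "taylor_coeff \<phi> n \<in> \<real>"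
    by (simp add: taylor_coeff_def fps_expansion_def Reals_divide)
  then show ?thesis
    by (simp add: mm_coeff_def)
qed

end

theory Submission
  imports Defs
begin

text \<open>
  Comparing coefficients in \<open>z f' / f = \<phi> \<circ> \<omega>\<close> gives, with \<open>c\<^sub>n\<close> the coefficients of the Schwarz
  function \<open>\<omega>\<close>, that \<open>-4 \<Gamma>\<^sub>2 = B\<^sub>1 c\<^sub>2 + (B\<^sub>2 - 2 B\<^sub>1\<^sup>2) c\<^sub>1\<^sup>2\<close> and
  \<open>-6 \<Gamma>\<^sub>3 = B\<^sub>1 (c\<^sub>3 + \<sigma>\<^sub>1 c\<^sub>1 c\<^sub>2 + \<mu>\<^sub>1 c\<^sub>1\<^sup>3)\<close>. The first is bounded with
  \<open>\<bar>c\<^sub>2\<bar> \<le> 1 - \<bar>c\<^sub>1\<bar>\<^sup>2\<close>, the second with the Prokhorov--Szynal inequality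
  \<open>\<bar>c\<^sub>3 + \<sigma> c\<^sub>1 c\<^sub>2 + \<mu> c\<^sub>1\<^sup>3\<bar> \<le> \<mu>\<close> on the three regions. The latter is obtained from the Schur
  parameters of \<open>\<omega>\<close>: on and above the parabola \<open>12 \<mu> = \<sigma>\<^sup>2 + 8\<close> (with \<open>\<mu> \<ge> 1\<close>) it reduces to AM-GM,
  and the third region follows by moving along the ray from \<open>(\<plusminus>4, 2)\<close>. For \<open>\<omega> z = \<i> z\<close> the
  number \<open>\<Gamma>\<^sub>2\<close> is real and \<open>\<Gamma>\<^sub>3\<close> is imaginary, so both bounds are attained without cancellation.
\<close>

unbundle no vec_syntax

subsection \<open>Schur parameters of a Schwarz function\<close>

lemma unimodular_point_imp_constant:
  assumes "s holomorphic_on unit_disc" "\<And>z. z \<in> unit_disc \<Longrightarrow> cmod (s z) \<le> 1"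
    and "z0 \<in> unit_disc" "cmod (s z0) = 1" "z \<in> unit_disc"
  shows "s z = s 0"
proof -
  have "s constant_on unit_disc"
    by (rule maximum_modulus_principle[of s unit_disc unit_disc z0])
      (use assms in \<open>auto intro: connected_ball\<close>)
  then show ?thesis
    using assms(5) by (auto simp: constant_on_def)
qed

lemma cmod_diff_le_cmod_one_minus_cnj:
  assumes "cmod c \<le> 1" "cmod s \<le> 1"
  shows "cmod (s - c) \<le> cmod (1 - cnj c * s)"
proof -
  have "(cmod (1 - cnj c * s))\<^sup>2 - (cmod (s - c))\<^sup>2 = (1 - (cmod c)\<^sup>2) * (1 - (cmod s)\<^sup>2)"
    unfolding cmod_power2 by (simp add: power2_eq_square algebra_simps)
  also have "\<dots> \<ge> 0"
    using assms by (intro mult_nonneg_nonneg) (auto simp: power_le_one)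
  finally show ?thesis
    by - (rule power2_le_imp_le, simp_all)
qed

text \<open>\<open>s'\<close> is the quotient of \<open>s z - s 0\<close> by
  \<open>z * (1 - cnj (s 0) * s z)\<close>, bounded by Schwarz's lemma. Stating the relation without
  division covers the case \<open>cmod (s 0) = 1\<close>: then \<open>s\<close> is constant and
  \<open>s' = 0\<close> serves.\<close>

lemma schur_step:
  assumes hol: "s holomorphic_on unit_disc" and le: "\<And>z. z \<in> unit_disc \<Longrightarrow> cmod (s z) \<le> 1"
  obtains s' where "s' holomorphic_on unit_disc" "\<And>z. z \<in> unit_disc \<Longrightarrow> cmod (s' z) \<le> 1"
    "\<And>z. z \<in> unit_disc \<Longrightarrow> s z = s 0 + z * s' z * (1 - cnj (s 0) * s z)"
proof (cases "cmod (s 0) = 1")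
  case True
  define c where "c = s 0"
  have c: "s z = c" if "z \<in> unit_disc" for z
    unfolding c_def by (rule unimodular_point_imp_constant[OF hol le _ True that]) auto
  show ?thesis
    by (rule that[of "\<lambda>_. 0"]) (auto simp: c)
next
  case False
  define c where "c = s 0"
  have c: "cmod c < 1"
    using False le[of 0] by (simp add: c_def)
  have ne: "1 - cnj c * s z \<noteq> 0" if "z \<in> unit_disc" for z
  proof
    assume "1 - cnj c * s z = 0"
    then have "cmod c * cmod (s z) = 1"
      using norm_mult[of "cnj c" "s z"] by simp
    moreover have "cmod c * cmod (s z) \<le> cmod c * 1"
      by (intro mult_left_mono le that) auto
    ultimately show False
      using c by simp
  qed
  define t where "t = (\<lambda>z. (s z - c) / (1 - cnj c * s z))"
  have t: "t holomorphic_on unit_disc"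
    unfolding t_def using ne by (intro holomorphic_intros hol) auto
  have t0: "t 0 = 0"
    by (simp add: t_def c_def)
  have tle: "cmod (t z) \<le> 1" if "z \<in> unit_disc" for z
    unfolding t_def norm_divide
    using cmod_diff_le_cmod_one_minus_cnj[of c "s z"] le[OF that] c ne[OF that]
    by (simp add: divide_le_eq)
  \<comment> \<open>Schwarz's lemma needs the strict bound. A value of modulus 1 inside the disc
    would make \<open>t\<close> constant, hence equal to \<open>t 0 = 0\<close>.\<close>
  have tless: "cmod (t z) < 1" if "cmod z < 1" for z
  proof (rule ccontr)
    assume "\<not> cmod (t z) < 1"
    then have "cmod (t z) = 1"
      using tle[of z] that by simp
    then have "t z = 0"
      using unimodular_point_imp_constant[OF t tle, of z z] that t0 by simp
    with \<open>cmod (t z) = 1\<close> show False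
      by simp
  qed
  obtain h where h: "h holomorphic_on unit_disc" "\<And>z. cmod z < 1 \<Longrightarrow> t z = z * h z"
      "deriv t 0 = h 0"
    by (rule Schwarz3[OF t t0]) (rule that)
  have "cmod (h z) \<le> 1" if z: "z \<in> unit_disc" for z
  proof (cases "z = 0")
    case True
    then show ?thesis
      using Schwarz_Lemma(2)[OF t t0 tless, of 0] h(3) by simp
  next
    case False
    then show ?thesis
      using Schwarz_Lemma(1)[OF t t0 tless, of z] h(2)[of z] z by (simp add: norm_mult)
  qed
  moreover have "s z = s 0 + z * h z * (1 - cnj (s 0) * s z)" if "z \<in> unit_disc" for z
    using h(2)[of z] ne[OF that] that unfolding t_def c_def[symmetric]
    by (simp add: divide_eq_eq diff_eq_eq add.commute)
  ultimately show ?thesis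
    using h(1) that by blast
qed

subsection \<open>The Prokhorov--Szynal inequality\<close>

text \<open>The term with \<open>\<eta>\<close> has modulus at most
  \<open>R = (1 - y) * (1 - t)\<close>, so the rest, \<open>N\<close>, must have modulus at most
  \<open>\<mu> - R\<close>. Maximizing over the argument of \<open>\<zeta>\<close> bounds
  \<open>N\<close> by \<open>(\<mu> * y + (1 - y) * t) * S\<close>, which is affine in
  \<open>t\<close>. At \<open>t = 1\<close> AM-GM bounds it by \<open>\<mu>\<close>, and decreasing
  \<open>t\<close> lowers it by at least \<open>R\<close>, since \<open>S \<ge> 1\<close>.\<close>

lemma prokhorov_szynal_parametric:
  fixes x \<sigma> \<mu> :: real and \<zeta> \<eta> :: complex
  assumes "0 \<le> x" "x \<le> 1" "cmod \<zeta> \<le> 1" "cmod \<eta> \<le> 1" "\<mu> \<ge> 1" "\<sigma>\<^sup>2 \<le> 12 * \<mu> - 8"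
  shows "cmod ((1 - x\<^sup>2) * ((1 - (cmod \<zeta>)\<^sup>2) * \<eta> - x * \<zeta>\<^sup>2) + \<sigma> * x * ((1 - x\<^sup>2) * \<zeta>) + \<mu> * x ^ 3) \<le> \<mu>"
proof -
  define y t where "y = x\<^sup>2" and "t = (cmod \<zeta>)\<^sup>2"
  define N where "N = \<mu> * x ^ 3 + x * (1 - y) * (\<sigma> * \<zeta> - \<zeta>\<^sup>2)"
  \<comment> \<open>Chosen so that \<open>4 * \<mu> * y + (1 - y) * \<sigma>\<^sup>2\<close> becomes
    \<open>4 * \<mu> * S\<^sup>2\<close> when \<open>\<sigma>\<^sup>2\<close> is replaced by its
    upper bound \<open>12 * \<mu> - 8\<close>.\<close>
  define S where "S = sqrt (1 + (1 - y) * (2 * (\<mu> - 1) / \<mu>))"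
  have y: "0 \<le> y" "y \<le> 1" and t: "0 \<le> t" "t \<le> 1"
    using assms by (auto simp: y_def t_def power_le_one)
  have S1: "S \<ge> 1"
    unfolding S_def using y assms by simp
  have S2: "\<mu> * S\<^sup>2 = \<mu> + 2 * (1 - y) * (\<mu> - 1)"
  proof -
    have "S\<^sup>2 = 1 + (1 - y) * (2 * (\<mu> - 1) / \<mu>)"
      unfolding S_def using y assms by (intro real_sqrt_pow2) simp
    then show ?thesis
      using assms by (simp add: field_simps)
  qed
  have N2: "(cmod N)\<^sup>2 = y * ((\<mu> * y + (1 - y) * (\<sigma> * Re \<zeta> - (Re \<zeta>)\<^sup>2 + (Im \<zeta>)\<^sup>2))\<^sup>2
      + ((1 - y) * (\<sigma> * Im \<zeta> - 2 * Re \<zeta> * Im \<zeta>))\<^sup>2)"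
  proof -
    define M where "M = \<mu> * y + (1 - y) * (\<sigma> * \<zeta> - \<zeta>\<^sup>2)"
    have "N = x * M"
      by (simp add: N_def M_def y_def power3_eq_cube power2_eq_square algebra_simps)
    then have "(cmod N)\<^sup>2 = y * (cmod M)\<^sup>2"
      by (simp add: norm_mult power_mult_distrib y_def)
    moreover have "Re M = \<mu> * y + (1 - y) * (\<sigma> * Re \<zeta> - (Re \<zeta>)\<^sup>2 + (Im \<zeta>)\<^sup>2)"
      "Im M = (1 - y) * (\<sigma> * Im \<zeta> - 2 * Re \<zeta> * Im \<zeta>)"
      by (simp_all add: M_def power2_eq_square)
    ultimately show ?thesis
      by (simp add: cmod_power2)
  qed
  have tz: "t = (Re \<zeta>)\<^sup>2 + (Im \<zeta>)\<^sup>2"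
    by (simp add: t_def cmod_power2)
  \<comment> \<open>\<open>\<bar>N\<bar>\<^sup>2\<close> is a concave quadratic in \<open>Re \<zeta>\<close> for fixed \<open>\<bar>\<zeta>\<bar>\<close>; the right-hand side
    measures how far it is below its value at the vertex.\<close>
  have id: "(\<mu> * y + (1 - y) * t)\<^sup>2 * (4 * \<mu> * y + (1 - y) * \<sigma>\<^sup>2) - 4 * \<mu> * (cmod N)\<^sup>2
      = (1 - y) * (4 * \<mu> * y * Re \<zeta> - \<sigma> * (\<mu> * y - (1 - y) * t))\<^sup>2"
    unfolding N2 tz by (simp add: power2_eq_square algebra_simps)
  have "4 * \<mu> * (cmod N)\<^sup>2 \<le> (\<mu> * y + (1 - y) * t)\<^sup>2 * (4 * \<mu> * y + (1 - y) * \<sigma>\<^sup>2)"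
    using id y by (smt (verit) mult_nonneg_nonneg zero_le_power2)
  also have "\<dots> \<le> (\<mu> * y + (1 - y) * t)\<^sup>2 * (4 * \<mu> * y + (1 - y) * (12 * \<mu> - 8))"
    using y assms by (intro mult_left_mono add_left_mono) auto
  also have "4 * \<mu> * y + (1 - y) * (12 * \<mu> - 8) = 4 * (\<mu> * S\<^sup>2)"
    unfolding S2 by (simp add: algebra_simps)
  finally have "4 * \<mu> * (cmod N)\<^sup>2 \<le> 4 * \<mu> * ((\<mu> * y + (1 - y) * t) * S)\<^sup>2"
    by (simp add: power_mult_distrib mult_ac)
  then have "(cmod N)\<^sup>2 \<le> ((\<mu> * y + (1 - y) * t) * S)\<^sup>2"
    using assms by simp
  then have N: "cmod N \<le> (\<mu> * y + (1 - y) * t) * S"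
  proof (rule power2_le_imp_le)
    show "0 \<le> (\<mu> * y + (1 - y) * t) * S"
      using y t S1 assms by (intro mult_nonneg_nonneg add_nonneg_nonneg) auto
  qed
  \<comment> \<open>The value of \<open>\<mu> * y + (1 - y) * t\<close> at \<open>t = 1\<close>. In
    terms of \<open>A\<close>, \<open>\<mu> * S\<^sup>2\<close> is
    \<open>3 * \<mu> - 2 * A\<close>.\<close>
  define A where "A = \<mu> * y + (1 - y)"
  have A: "A \<ge> 0"
    using y assms by (simp add: A_def)
  have "\<mu> * (A * S)\<^sup>2 = A\<^sup>2 * (\<mu> * S\<^sup>2)"
    by (simp add: power_mult_distrib)
  also have "\<dots> = A\<^sup>2 * (3 * \<mu> - 2 * A)"
    unfolding S2 by (simp add: A_def algebra_simps)
  \<comment> \<open>AM-GM for \<open>A\<close>, \<open>A\<close> and \<open>3 \<mu> - 2 A\<close>\<close>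
  also have "\<dots> = \<mu> ^ 3 - (\<mu> - A)\<^sup>2 * (\<mu> + 2 * A)"
    by (simp add: power2_eq_square power3_eq_cube algebra_simps)
  also have "\<dots> \<le> \<mu> * \<mu>\<^sup>2"
    using A assms by (simp add: power3_eq_cube power2_eq_square)
  finally have "(A * S)\<^sup>2 \<le> \<mu>\<^sup>2"
    using assms by simp
  then have AS: "A * S \<le> \<mu>"
    using assms by (meson order_trans power2_le_imp_le zero_le_one)
  have "(\<mu> * y + (1 - y) * t) * S = A * S - (1 - y) * (1 - t) * S"
    by (simp add: A_def algebra_simps)
  also have "\<dots> \<le> \<mu> - (1 - y) * (1 - t) * 1"
    using AS S1 y t by (intro diff_mono mult_left_mono) auto
  finally have NN: "cmod N \<le> \<mu> - (1 - y) * (1 - t)"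
    using N by simp
  define R where "R = (1 - y) * (1 - t)"
  have "R \<ge> 0"
    using y t by (simp add: R_def)
  then have "cmod (R * \<eta>) \<le> R"
    using assms by (simp add: norm_mult mult_left_le)
  then have "cmod (N + R * \<eta>) \<le> \<mu>"
    using NN norm_triangle_ineq[of N "R * \<eta>"] unfolding R_def[symmetric] by linarith
  then show ?thesis
    by (simp add: N_def R_def y_def t_def power2_eq_square power3_eq_cube algebra_simps)
qed

section \<open>Taylor coefficients in terms of Schur parameters\<close>

lemma holomorphic_unit_disc_fps:
  "f holomorphic_on unit_disc \<Longrightarrow> f has_fps_expansion fps_expansion f 0"
  by (rule has_fps_expansion_fps_expansion[of unit_disc]) auto

lemma fps_eq_of_eq_on_unit_disc:
  assumes "\<And>z. z \<in> unit_disc \<Longrightarrow> f z = g z" "f has_fps_expansion F" "g has_fps_expansion G"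
  shows "F = G"
proof -
  have "\<forall>\<^sub>F z in nhds 0. f z = g z"
    using eventually_nhds_in_open[of unit_disc 0] by (auto elim!: eventually_mono simp: assms(1))
  then have "f has_fps_expansion G"
    using has_fps_expansion_cong[of f g G G] assms(3) by simp
  then show ?thesis
    using assms(2) fps_expansion_unique_complex by blast
qed

text \<open>Three Schur steps are applied, the first of which just divides by \<open>z\<close>
  because \<open>\<omega> 0 = 0\<close>. The parameters \<open>c\<close>, \<open>\<zeta>\<close>,
  \<open>\<eta>\<close> are the values at 0 of the three successive functions, hence of modulus at
  most 1.\<close>

lemma schwarz_coeff_parametrization:
  assumes hol: "\<omega> holomorphic_on unit_disc" and "\<omega> 0 = 0"
    and le: "\<And>z. z \<in> unit_disc \<Longrightarrow> cmod (\<omega> z) \<le> 1"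
  obtains c \<zeta> \<eta> :: complex where "cmod c \<le> 1" "cmod \<zeta> \<le> 1" "cmod \<eta> \<le> 1"
    "taylor_coeff \<omega> 1 = c"
    "taylor_coeff \<omega> 2 = (1 - (cmod c)\<^sup>2) * \<zeta>"
    "taylor_coeff \<omega> 3 = (1 - (cmod c)\<^sup>2) * ((1 - (cmod \<zeta>)\<^sup>2) * \<eta> - cnj c * \<zeta>\<^sup>2)"
proof -
  obtain s where s: "s holomorphic_on unit_disc" "\<And>z. z \<in> unit_disc \<Longrightarrow> cmod (s z) \<le> 1"
      "\<And>z. z \<in> unit_disc \<Longrightarrow> \<omega> z = \<omega> 0 + z * s z * (1 - cnj (\<omega> 0) * \<omega> z)"
    by (rule schur_step[OF hol le], assumption) (rule that)
  obtain s1 where s1: "s1 holomorphic_on unit_disc" "\<And>z. z \<in> unit_disc \<Longrightarrow> cmod (s1 z) \<le> 1"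
      "\<And>z. z \<in> unit_disc \<Longrightarrow> s z = s 0 + z * s1 z * (1 - cnj (s 0) * s z)"
    by (rule schur_step[OF s(1,2)], assumption) (rule that)
  obtain s2 where s2: "s2 holomorphic_on unit_disc" "\<And>z. z \<in> unit_disc \<Longrightarrow> cmod (s2 z) \<le> 1"
      "\<And>z. z \<in> unit_disc \<Longrightarrow> s1 z = s1 0 + z * s2 z * (1 - cnj (s1 0) * s1 z)"
    by (rule schur_step[OF s1(1,2)], assumption) (rule that)
  define W S S1 S2 where "W = fps_expansion \<omega> 0" and "S = fps_expansion s 0"
    and "S1 = fps_expansion s1 0" and "S2 = fps_expansion s2 0"
  note exps = holomorphic_unit_disc_fps[OF hol, folded W_def]
    holomorphic_unit_disc_fps[OF s(1), folded S_def]
    holomorphic_unit_disc_fps[OF s1(1), folded S1_def]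
    holomorphic_unit_disc_fps[OF s2(1), folded S2_def]
  have nth0: "S $ 0 = s 0" "S1 $ 0 = s1 0" "S2 $ 0 = s2 0"
    by (simp_all add: S_def S1_def S2_def fps_expansion_def)
  have W: "W = fps_X * S"
    by (rule fps_eq_of_eq_on_unit_disc[OF _ exps(1)], rule s(3)[unfolded assms(2)])
      (auto intro!: fps_expansion_intros exps)
  have S: "S = fps_const (s 0) + fps_X * S1 * (1 - fps_const (cnj (s 0)) * S)"
    by (rule fps_eq_of_eq_on_unit_disc[OF s1(3) exps(2)]) (auto intro!: fps_expansion_intros exps)
  have S1: "S1 = fps_const (s1 0) + fps_X * S2 * (1 - fps_const (cnj (s1 0)) * S1)"
    by (rule fps_eq_of_eq_on_unit_disc[OF s2(3) exps(3)]) (auto intro!: fps_expansion_intros exps)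
  have cn: "(complex_of_real (cmod z))\<^sup>2 = z * cnj z" for z
    using complex_norm_square[of z] by simp
  \<comment> \<open>\<open>S\<close> and \<open>S1\<close> occur on both sides of their equations,
    but on the right behind a factor \<open>fps_X\<close>, so each coefficient is determined by
    earlier ones.\<close>
  have S_1: "S $ 1 = (1 - (cmod (s 0))\<^sup>2) * s1 0"
    by (subst S) (simp add: nth0 mult.assoc cn algebra_simps)
  have S1_1: "S1 $ 1 = (1 - (cmod (s1 0))\<^sup>2) * s2 0"
    by (subst S1) (simp add: nth0 mult.assoc cn algebra_simps)
  have "S $ 2 = (S1 * (1 - fps_const (cnj (s 0)) * S)) $ 1"
    by (subst S) (simp add: mult.assoc)
  also have "\<dots> = S1 $ 1 * (1 - (cmod (s 0))\<^sup>2) - cnj (s 0) * s1 0 * S $ 1"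
    by (simp add: nth0 cn algebra_simps)
  finally have S_2: "S $ 2 = (1 - (cmod (s 0))\<^sup>2) *
      ((1 - (cmod (s1 0))\<^sup>2) * s2 0 - cnj (s 0) * (s1 0)\<^sup>2)"
    unfolding S_1 S1_1 by (simp add: cn power2_eq_square algebra_simps)
  show ?thesis
    using that[of "s 0" "s1 0" "s2 0"] s(2)[of 0] s1(2)[of 0] s2(2)[of 0] S_1 S_2 nth0
    by (simp add: taylor_coeff_def W_def[symmetric] W)
qed

section \<open>The inequality for complex parameters and on all three regions\<close>

lemma prokhorov_szynal_parabola:
  fixes \<sigma> \<mu> :: real and c \<zeta> \<eta> :: complex
  assumes "cmod c \<le> 1" "cmod \<zeta> \<le> 1" "cmod \<eta> \<le> 1" "\<mu> \<ge> 1" "\<sigma>\<^sup>2 \<le> 12 * \<mu> - 8"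
  shows "cmod ((1 - (cmod c)\<^sup>2) * ((1 - (cmod \<zeta>)\<^sup>2) * \<eta> - cnj c * \<zeta>\<^sup>2)
    + \<sigma> * c * ((1 - (cmod c)\<^sup>2) * \<zeta>) + \<mu> * c ^ 3) \<le> \<mu>"
proof -
  define x where "x = cmod c"
  obtain u :: complex where u: "cmod u = 1" "c = x * u"
  proof (cases "c = 0")
    case True
    then show ?thesis
      using that[of 1] by (simp add: x_def)
  next
    case False
    then show ?thesis
      using that[of "c / cmod c"] by (simp add: x_def norm_divide)
  qed
  have uu: "u * cnj u = 1"
    using u(1) complex_norm_square[of u] by simp
  \<comment> \<open>rotating \<open>\<omega>\<close> to \<open>\<omega> (cnj u z)\<close> makes \<open>c\<close> nonnegative\<close>
  define \<zeta>' \<eta>' where "\<zeta>' = \<zeta> * cnj u ^ 2" and "\<eta>' = \<eta> * cnj u ^ 3"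
  have z: "\<zeta> = u\<^sup>2 * \<zeta>'" "\<eta> = u ^ 3 * \<eta>'" "cmod \<zeta>' = cmod \<zeta>" "cmod \<eta>' = cmod \<eta>"
    using u(1) uu unfolding \<zeta>'_def \<eta>'_def
    by (simp_all add: norm_mult norm_power mult.left_commute flip: power_mult_distrib)
  have "cnj c * \<zeta>\<^sup>2 = u ^ 3 * (u * cnj u) * (x * \<zeta>'\<^sup>2)"
    unfolding u(2) z(1) by (simp add: power2_eq_square power3_eq_cube mult_ac)
  then have cz: "cnj c * \<zeta>\<^sup>2 = u ^ 3 * (x * \<zeta>'\<^sup>2)"
    by (simp only: uu mult_1_right)
  have c3: "c ^ 3 = u ^ 3 * x ^ 3" "c * \<zeta> = u ^ 3 * (x * \<zeta>')"
    unfolding u(2) z(1) by (simp_all add: power2_eq_square power3_eq_cube mult_ac)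
  \<comment> \<open>With \<open>c\<close>, \<open>\<zeta>\<close>, \<open>\<eta>\<close> carrying
    the phases \<open>u\<close>, \<open>u^2\<close>, \<open>u^3\<close>, every summand carries
    \<open>u^3\<close>. This common factor has modulus 1.\<close>
  have "(1 - (cmod c)\<^sup>2) * ((1 - (cmod \<zeta>)\<^sup>2) * \<eta> - cnj c * \<zeta>\<^sup>2)
      + \<sigma> * c * ((1 - (cmod c)\<^sup>2) * \<zeta>) + \<mu> * c ^ 3
    = (1 - x\<^sup>2) * ((1 - (cmod \<zeta>)\<^sup>2) * \<eta> - cnj c * \<zeta>\<^sup>2)
      + \<sigma> * (1 - x\<^sup>2) * (c * \<zeta>) + \<mu> * c ^ 3"
    by (simp add: x_def mult_ac)
  also have "\<dots> = u ^ 3 * ((1 - x\<^sup>2) * ((1 - (cmod \<zeta>')\<^sup>2) * \<eta>' - x * \<zeta>'\<^sup>2)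
      + \<sigma> * x * ((1 - x\<^sup>2) * \<zeta>') + \<mu> * x ^ 3)"
    unfolding cz c3 z(3) by (subst z(2)) (simp add: algebra_simps)
  finally show ?thesis
    using prokhorov_szynal_parametric[of x \<zeta>' \<eta>' \<mu> \<sigma>] assms z(3,4) u(1)
    by (simp add: norm_mult norm_power x_def)
qed

lemma prokhorov_szynal:
  fixes \<sigma> \<mu> :: real
  assumes "\<omega> holomorphic_on unit_disc" and "\<omega> 0 = 0"
    and "\<And>z. z \<in> unit_disc \<Longrightarrow> cmod (\<omega> z) \<le> 1"
    and \<Omega>: "(\<sigma>, \<mu>) \<in> Omega1 \<union> Omega2 \<union> Omega3"
  shows "cmod (taylor_coeff \<omega> 3 + \<sigma> * taylor_coeff \<omega> 1 * taylor_coeff \<omega> 2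
    + \<mu> * taylor_coeff \<omega> 1 ^ 3) \<le> \<mu>"
proof -
  obtain c \<zeta> \<eta> :: complex where par: "cmod c \<le> 1" "cmod \<zeta> \<le> 1" "cmod \<eta> \<le> 1"
    and tc: "taylor_coeff \<omega> 1 = c" "taylor_coeff \<omega> 2 = (1 - (cmod c)\<^sup>2) * \<zeta>"
      "taylor_coeff \<omega> 3 = (1 - (cmod c)\<^sup>2) * ((1 - (cmod \<zeta>)\<^sup>2) * \<eta> - cnj c * \<zeta>\<^sup>2)"
    by (rule schwarz_coeff_parametrization[OF assms(1-3)])
  show ?thesis
  proof (cases "\<bar>\<sigma>\<bar> \<le> 4")
    case True
    \<comment> \<open>\<open>Omega1\<close> and \<open>Omega2\<close> lie on or above the parabola;
      of \<open>Omega3\<close> only the edge where \<open>\<bar>\<sigma>\<bar> = 4\<close> is left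
      here.\<close>
    have "\<mu> \<ge> 1 \<and> \<sigma>\<^sup>2 \<le> 12 * \<mu> - 8"
    proof -
      consider "\<bar>\<sigma>\<bar> \<le> 2" "\<mu> \<ge> 1" | "2 \<le> \<bar>\<sigma>\<bar>" "\<mu> \<ge> (1/12) * (\<sigma>\<^sup>2 + 8)" | "\<bar>\<sigma>\<bar> = 4" "\<mu> \<ge> 2"
        using \<Omega> True by (auto simp: Omega1_def Omega2_def Omega3_def)
      then show ?thesis
      proof cases
        case 1
        then show ?thesis
          using power_mono[of "\<bar>\<sigma>\<bar>" 2 2] by simp
      next
        case 2
        then show ?thesis
          using power_mono[of 2 "\<bar>\<sigma>\<bar>" 2] by simp
      next
        case 3
        then have "\<sigma>\<^sup>2 = 16"
          using power2_abs[of \<sigma>] by simp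
        with 3 show ?thesis
          by simp
      qed
    qed
    then show ?thesis
      unfolding tc using prokhorov_szynal_parabola[OF par] by blast
  next
    case False
    then have \<mu>: "\<mu> \<ge> 2/3 * (\<bar>\<sigma>\<bar> - 1)"
      using \<Omega> by (auto simp: Omega1_def Omega2_def Omega3_def)
    \<comment> \<open>The point \<open>(\<tau>, 2)\<close> is the corner where the parabola meets
      the boundary line of \<open>Omega3\<close>; \<open>v\<close> and \<open>w\<close> are the
      displacements from it.\<close>
    define \<tau> v w where "\<tau> = 4 * sgn \<sigma>" and "v = \<sigma> - \<tau>" and "w = \<mu> - 2"
    have v: "\<bar>v\<bar> = \<bar>\<sigma>\<bar> - 4"
      using False by (auto simp: v_def \<tau>_def sgn_if abs_if)
    have \<tau>: "\<tau>\<^sup>2 = 16"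
      using False by (auto simp: \<tau>_def sgn_if)
    define A B where "A = taylor_coeff \<omega> 1 * taylor_coeff \<omega> 2" and "B = taylor_coeff \<omega> 1 ^ 3"
    have x: "(cmod c)\<^sup>2 \<le> 1"
      using par(1) by (simp add: power_le_one)
    have "cmod A = cmod c * ((1 - (cmod c)\<^sup>2) * cmod \<zeta>)"
      unfolding A_def tc norm_mult norm_of_real using x by simp
    also have "\<dots> \<le> cmod c * ((1 - (cmod c)\<^sup>2) * 1)"
      using par x by (intro mult_left_mono) auto
    finally have A: "cmod A \<le> cmod c - cmod c ^ 3"
      by (simp add: power2_eq_square power3_eq_cube algebra_simps)
    have B: "cmod B = cmod c ^ 3"
      unfolding B_def tc by (rule norm_power)
    have B1: "cmod B \<le> 1"
      using par(1) by (simp add: B power_le_one)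
    \<comment> \<open>The constant 2/3 is the slope of the boundary of \<open>Omega3\<close>. Hence
      the loss \<open>\<bar>v\<bar> * cmod A\<close> is at most
      \<open>(\<mu> - 2) * (1 - cmod B)\<close>, exactly what the term \<open>w * B\<close> leaves
      free.\<close>
    have AB: "cmod A \<le> 2/3 * (1 - cmod B)"
    proof -
      have "(2/3) * (1 - cmod c ^ 3) - (cmod c - cmod c ^ 3) = (1 - cmod c)\<^sup>2 * (2 + cmod c) / 3"
        by (simp add: power2_eq_square power3_eq_cube algebra_simps)
      also have "\<dots> \<ge> 0"
        by simp
      finally show ?thesis
        using A B by simp
    qed
    have *: "cmod (taylor_coeff \<omega> 3 + \<tau> * A + 2 * B) \<le> 2"
      using prokhorov_szynal_parabola[OF par, of 2 \<tau>] \<tau> unfolding A_def B_def tc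
      by (simp add: mult.assoc)
    have "cmod (taylor_coeff \<omega> 3 + \<sigma> * A + \<mu> * B)
        = cmod ((taylor_coeff \<omega> 3 + \<tau> * A + 2 * B) + of_real v * A + of_real w * B)"
      by (simp add: v_def w_def algebra_simps)
    also have "\<dots> \<le> 2 + \<bar>v\<bar> * cmod A + \<bar>w\<bar> * cmod B"
      using * by (intro norm_triangle_mono) (auto simp: norm_mult)
    also have "\<dots> \<le> 2 + \<bar>v\<bar> * (2/3 * (1 - cmod B)) + \<bar>w\<bar> * cmod B"
      using AB by (intro add_mono mult_left_mono) auto
    also have "\<dots> \<le> 2 + (\<mu> - 2) * (1 - cmod B) + (\<mu> - 2) * cmod B"
    proof -
      have "(2/3 * \<bar>v\<bar>) * (1 - cmod B) \<le> (\<mu> - 2) * (1 - cmod B)"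
        using B1 \<mu> v by (intro mult_right_mono) auto
      then show ?thesis
        using \<mu> False by (simp add: w_def mult_ac)
    qed
    finally show ?thesis
      by (simp add: A_def B_def algebra_simps)
  qed
qed

subsection \<open>Logarithmic coefficients of the inverse\<close>

text \<open>\<open>G\<close> expands the inverse and \<open>L\<close> the function
  \<open>log (g w / w)\<close>. Logarithmic differentiation of \<open>G = fps_X * exp L\<close>
  gives the first product identity. Composing \<open>P * F = fps_X * fps_deriv F\<close> with
  \<open>G\<close> and using \<open>F oo G = fps_X\<close> gives the second, in which the
  coefficients of \<open>f\<close> no longer appear.\<close>

lemma log_inv_coeff_fps:
  assumes f: "f \<in> class_A" and p: "p has_fps_expansion P"
    and ev: "\<forall>\<^sub>F z in nhds 0. p z * f z = z * deriv f z"
  obtains G L where "L $ 0 = 0" "\<And>n. log_inv_coeff f n = L $ n / 2"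
    "G $ 0 = 0" "G $ 1 = 1" "G * (1 + fps_X * fps_deriv L) = fps_X * fps_deriv G"
    "(P oo G) * (1 + fps_X * fps_deriv L) = 1"
proof -
  obtain g where g: "is_local_inverse f g"
    using is_local_inverse_exists[OF f] by blast
  have f': "f holomorphic_on unit_disc" "f 0 = 0" "deriv f 0 = 1"
    using f by (auto simp: class_A_def)
  have g': "g analytic_on {0}" "g 0 = 0" "\<forall>\<^sub>F w in nhds 0. f (g w) = w"
    using g by (auto simp: is_local_inverse_def)
  define F G where "F = fps_expansion f 0" and "G = fps_expansion g 0"
  have F: "f has_fps_expansion F"
    unfolding F_def by (rule holomorphic_unit_disc_fps[OF f'(1)])
  have G: "g has_fps_expansion G"
    unfolding G_def by (rule analytic_at_imp_has_fps_expansion_0[OF g'(1)])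
  have F_nth: "F $ 0 = 0" "F $ 1 = 1"
    using f' by (simp_all add: F_def fps_expansion_def)
  have G0: "G $ 0 = 0"
    using g' by (simp add: G_def fps_expansion_def)
  have "(f \<circ> g) has_fps_expansion (F oo G)"
    by (rule has_fps_expansion_compose[OF F G G0])
  moreover have "(f \<circ> g) has_fps_expansion fps_X"
    using has_fps_expansion_cong[of "f \<circ> g" "\<lambda>w. w" fps_X fps_X] g'(3) has_fps_expansion_fps_X
    by simp
  ultimately have FG: "F oo G = fps_X"
    using fps_expansion_unique_complex by blast
  have "(F oo G) $ 1 = F $ 1 * G $ 1"
    by (simp add: fps_compose_nth)
  then have G1: "G $ 1 = 1"
    using F_nth(2) by (simp add: FG)
  have "(\<lambda>z. p z * f z) has_fps_expansion P * F"
    by (intro fps_expansion_intros p F)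
  moreover have "(\<lambda>z. p z * f z) has_fps_expansion fps_X * fps_deriv F"
    using has_fps_expansion_cong[OF ev refl] has_fps_expansion_mult[OF has_fps_expansion_fps_X has_fps_expansion_deriv[OF F]]
    by blast
  ultimately have "P * F = fps_X * fps_deriv F"
    using fps_expansion_unique_complex by blast
  then have "(P * F) oo G = (fps_X * fps_deriv F) oo G"
    by simp
  then have PG: "(P oo G) * fps_X = G * (fps_deriv F oo G)"
    by (simp add: fps_compose_mult_distrib[OF G0] FG G0)
  have "fps_deriv (F oo G) = (fps_deriv F oo G) * fps_deriv G"
    by (rule fps_compose_deriv[OF G0])
  then have dG: "(fps_deriv F oo G) * fps_deriv G = 1"
    by (simp add: FG)
  have PG': "(P oo G) * (fps_X * fps_deriv G) = G"
    using arg_cong[OF PG, of "\<lambda>H. H * fps_deriv G"] by (simp add: mult.assoc dG)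

  \<comment> \<open>\<open>h\<close> is \<open>g w / w\<close> with its singularity at 0 removed.
    Since \<open>h 0 = 1\<close>, the principal logarithm of \<open>h\<close> is analytic there,
    with value 0. The exponent in \<open>w ^ 1\<close> matches the shift by one.\<close>
  define H h where "H = fps_shift 1 G" and "h = (\<lambda>w. if w = 0 then 1 else g w / w ^ 1)"
  have sub: "1 \<le> subdegree G"
    using G0 G1 by (intro subdegree_geI) auto
  have h: "h has_fps_expansion H"
    unfolding H_def h_def by (rule has_fps_expansion_shift[OF G sub]) (use G1 in simp)
  have h0: "h 0 = 1"
    by (simp add: h_def)
  have h_an: "h analytic_on {0}"
    using h by (rule has_fps_expansion_imp_analytic_0)
  define l where "l = (\<lambda>w. Ln (h w))"
  have l_an: "l analytic_on {0}"
    unfolding l_def by (intro analytic_intros h_an) (auto simp: h0)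
  define L where "L = fps_expansion l 0"
  have L: "l has_fps_expansion L"
    unfolding L_def by (rule analytic_at_imp_has_fps_expansion_0[OF l_an])
  have L0: "L $ 0 = 0"
    by (simp add: L_def fps_expansion_def l_def h0)
  have l_eq: "l = (\<lambda>w. if w = 0 then 0 else Ln (g w / w))"
    by (auto simp: l_def h_def)
  have "isCont h 0"
    using h_an analytic_at_imp_isCont by blast
  then have "\<forall>\<^sub>F w in nhds 0. h w \<noteq> 0"
    using h0 by (metis continuous_at tendsto_imp_eventually_ne tendsto_nhds_iff zero_neq_one)
  then have "\<forall>\<^sub>F w in nhds 0. g w = w * exp (l w)"
    by eventually_elim (auto simp: l_def h_def g'(2))
  moreover have "(\<lambda>w. w * exp (l w)) has_fps_expansion fps_X * (fps_exp 1 oo L)"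
    using has_fps_expansion_compose[OF has_fps_expansion_exp1 L L0]
    by (intro fps_expansion_intros) (simp add: o_def)
  ultimately have "g has_fps_expansion fps_X * (fps_exp 1 oo L)"
    using has_fps_expansion_cong[OF _ refl, of g "\<lambda>w. w * exp (l w)"] by simp
  then have GE: "G = fps_X * (fps_exp 1 oo L)"
    using G fps_expansion_unique_complex by blast
  have dE: "fps_deriv (fps_exp 1 oo L) = (fps_exp 1 oo L) * fps_deriv L"
    by (simp add: fps_compose_deriv[OF L0])
  have GL: "G * (1 + fps_X * fps_deriv L) = fps_X * fps_deriv G"
    unfolding GE by (simp add: dE algebra_simps)
  have "G * ((P oo G) * (1 + fps_X * fps_deriv L)) = G * 1"
    using PG' unfolding GL[symmetric] by (simp add: mult_ac)
  moreover have "G \<noteq> 0"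
    using G1 by auto
  ultimately have "(P oo G) * (1 + fps_X * fps_deriv L) = 1"
    using mult_left_cancel by blast
  moreover have "log_inv_coeff f n = L $ n / 2" for n
    unfolding log_inv_coeff_eq[OF f g] taylor_coeff_def L_def l_eq ..
  ultimately show ?thesis
    using that L0 G0 G1 GL by blast
qed

text \<open>With \<open>C = P oo G\<close> and \<open>M = 1 + fps_X * fps_deriv L\<close>, the
  relations \<open>C * M = 1\<close> and \<open>G * M = fps_X * fps_deriv G\<close> form a
  triangular system: they yield \<open>L $ 1\<close>, \<open>G $ 2\<close>, \<open>L $ 2\<close>,
  \<open>G $ 3\<close>, \<open>L $ 3\<close> in turn.\<close>

lemma log_inv_coeff_2_3:
  assumes f: "f \<in> class_A" and p: "p has_fps_expansion P" and P0: "P $ 0 = 1"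
    and ev: "\<forall>\<^sub>F z in nhds 0. p z * f z = z * deriv f z"
  shows "log_inv_coeff f 2 = - (P $ 2 - 2 * (P $ 1)\<^sup>2) / 4"
    and "log_inv_coeff f 3 = - (2 * P $ 3 - 9 * P $ 1 * P $ 2 + 9 * (P $ 1) ^ 3) / 12"
proof -
  obtain G L where L0: "L $ 0 = 0" and lic: "\<And>n. log_inv_coeff f n = L $ n / 2"
    and G0: "G $ 0 = 0" and G1: "G $ 1 = 1"
    and GL: "G * (1 + fps_X * fps_deriv L) = fps_X * fps_deriv G"
    and PL: "(P oo G) * (1 + fps_X * fps_deriv L) = 1"
    by (rule log_inv_coeff_fps[OF f p ev]) (rule that)
  define C where "C = P oo G"
  have C: "C $ 0 = 1" "C $ 1 = P $ 1" "C $ 2 = P $ 1 * G $ 2 + P $ 2"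
    "C $ 3 = P $ 1 * G $ 3 + 2 * P $ 2 * G $ 2 + P $ 3"
    using G0 G1 P0
    by (simp_all add: C_def fps_compose_nth numeral_2_eq_2 numeral_3_eq_3 fps_mult_nth)
  define M where "M = 1 + fps_X * fps_deriv L"
  have M: "M $ 0 = 1" "M $ 1 = L $ 1" "M $ 2 = 2 * L $ 2" "M $ 3 = 3 * L $ 3"
    by (simp_all add: M_def numeral_2_eq_2 numeral_3_eq_3)
  have CM: "(C * M) $ Suc n = 0" for n
    using PL by (simp add: C_def M_def)
  have GM: "(G * M) $ n = (fps_X * fps_deriv G) $ n" for n
    using GL by (simp add: M_def)
  have e1: "P $ 1 + L $ 1 = 0"
    using CM[of 0] C M by (simp add: add.commute)
  have e2: "C $ 2 + C $ 1 * M $ 1 + M $ 2 = 0"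
    using CM[of 1] C M by (simp add: fps_mult_nth numeral_2_eq_2 add_ac)
  have e3: "C $ 3 + C $ 2 * M $ 1 + C $ 1 * M $ 2 + M $ 3 = 0"
    using CM[of 2] C M by (simp add: fps_mult_nth numeral_2_eq_2 numeral_3_eq_3 add_ac)
  have g2: "M $ 1 = G $ 2"
    using GM[of 2] G0 G1 M by (simp add: fps_mult_nth numeral_2_eq_2)
  have g3: "M $ 2 + G $ 2 * M $ 1 = 2 * G $ 3"
    using GM[of 3] G0 G1 M by (simp add: fps_mult_nth numeral_2_eq_2 numeral_3_eq_3)
  have L1: "L $ 1 = - P $ 1"
    using e1 by (simp add: eq_neg_iff_add_eq_0 add.commute)
  have G2: "G $ 2 = - P $ 1"
    using g2 M L1 by simp
  have L2: "2 * L $ 2 = 2 * (P $ 1)\<^sup>2 - P $ 2"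
    using e2 unfolding C M G2 L1 by (simp add: power2_eq_square algebra_simps)
  have G3: "2 * G $ 3 = 3 * (P $ 1)\<^sup>2 - P $ 2"
    using g3 unfolding M L2 G2 L1 by (simp add: power2_eq_square)
  have "6 * L $ 3 = - (P $ 1 * (2 * G $ 3) + 4 * P $ 2 * G $ 2 + 2 * P $ 3
      + 2 * C $ 2 * M $ 1 + 2 * P $ 1 * (2 * L $ 2))"
    using e3 unfolding C M by algebra
  then have L3: "6 * L $ 3 = - (2 * P $ 3 - 9 * P $ 1 * P $ 2 + 9 * (P $ 1) ^ 3)"
    unfolding G3 C M L2 L1 G2 by (simp add: power2_eq_square power3_eq_cube algebra_simps)
  show "log_inv_coeff f 2 = - (P $ 2 - 2 * (P $ 1)\<^sup>2) / 4"
    unfolding lic using L2 by (simp add: field_simps)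
  show "log_inv_coeff f 3 = - (2 * P $ 3 - 9 * P $ 1 * P $ 2 + 9 * (P $ 1) ^ 3) / 12"
    unfolding lic using L3 by (simp add: field_simps)
qed

lemma starlike_class_log_inv_coeff:
  assumes \<phi>: "ma_minda \<phi>" and f: "f \<in> class_A"
    and \<omega>: "\<omega> holomorphic_on unit_disc" "\<omega> 0 = 0"
    and q: "\<forall>z\<in>unit_disc. starlike_quotient f z = \<phi> (\<omega> z)"
  defines "B \<equiv> \<lambda>n. complex_of_real (mm_coeff \<phi> n)" and "c \<equiv> taylor_coeff \<omega>"
  shows "log_inv_coeff f 2 = - (B 1 * c 2 + (B 2 - 2 * (B 1)\<^sup>2) * (c 1)\<^sup>2) / 4"
    and "log_inv_coeff f 3 = - (2 * B 1 * c 3 - (9 * (B 1)\<^sup>2 - 4 * B 2) * c 1 * c 2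
      + (9 * B 1 ^ 3 - 9 * B 1 * B 2 + 2 * B 3) * c 1 ^ 3) / 12"
proof -
  have hol: "\<phi> holomorphic_on unit_disc" and \<phi>0: "\<phi> 0 = 1"
    and pos: "\<And>z. z \<in> unit_disc \<Longrightarrow> Re (\<phi> z) > 0"
    using \<phi> by (auto simp: ma_minda_def)
  define W \<Phi> P where "W = fps_expansion \<omega> 0" and "\<Phi> = fps_expansion \<phi> 0" and "P = \<Phi> oo W"
  have W: "W $ n = c n" for n
    by (simp add: W_def c_def taylor_coeff_def)
  have W0: "W $ 0 = 0"
    by (simp add: W_def fps_expansion_def \<omega>(2))
  have \<Phi>: "\<Phi> $ n = B n" for n
    using ma_minda_coeff_real[OF \<phi>, of n] by (simp add: \<Phi>_def B_def taylor_coeff_def)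
  have "\<Phi> $ 0 = 1"
    by (simp add: \<Phi>_def fps_expansion_def \<phi>0)
  then have P: "P $ 0 = 1" "P $ 1 = B 1 * c 1" "P $ 2 = B 1 * c 2 + B 2 * (c 1)\<^sup>2"
    "P $ 3 = B 1 * c 3 + 2 * B 2 * c 1 * c 2 + B 3 * c 1 ^ 3"
    using W0 unfolding P_def
    by (simp_all add: fps_compose_nth numeral_2_eq_2 numeral_3_eq_3 fps_mult_nth W \<Phi>)
  have p: "(\<phi> \<circ> \<omega>) has_fps_expansion P"
    unfolding P_def using W0 unfolding W_def \<Phi>_def
    by (intro has_fps_expansion_compose holomorphic_unit_disc_fps hol \<omega>)
  have "isCont \<omega> 0"
    using holomorphic_on_imp_continuous_on[OF \<omega>(1)] by (simp add: continuous_on_eq_continuous_at)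
  then have "(\<omega> \<longlongrightarrow> 0) (nhds 0)"
    using \<omega>(2) by (simp add: continuous_at tendsto_nhds_iff)
  then have "\<forall>\<^sub>F z in nhds 0. \<omega> z \<in> unit_disc"
    by (rule topological_tendstoD) auto
  moreover have "\<forall>\<^sub>F z in nhds 0. z \<in> unit_disc"
    by (rule eventually_nhds_in_open) auto
  ultimately have ev: "\<forall>\<^sub>F z in nhds 0. (\<phi> \<circ> \<omega>) z * f z = z * deriv f z"
  proof eventually_elim
    case (elim z)
    have qz: "starlike_quotient f z = \<phi> (\<omega> z)"
      using q elim(2) by blast
    \<comment> \<open>This excludes a zero of \<open>f\<close> away from 0, where division by zero
      would make the quotient 0.\<close>
    have "starlike_quotient f z \<noteq> 0"
      using qz pos[OF elim(1)] by auto
    moreover have "f 0 = 0"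
      using f by (simp add: class_A_def)
    ultimately show ?case
      using qz by (auto simp: starlike_quotient_def divide_simps split: if_splits)
  qed
  note * = log_inv_coeff_2_3[OF f p P(1) ev]
  show "log_inv_coeff f 2 = - (B 1 * c 2 + (B 2 - 2 * (B 1)\<^sup>2) * (c 1)\<^sup>2) / 4"
    unfolding *(1) P by (simp add: power_mult_distrib algebra_simps)
  show "log_inv_coeff f 3 = - (2 * B 1 * c 3 - (9 * (B 1)\<^sup>2 - 4 * B 2) * c 1 * c 2
      + (9 * B 1 ^ 3 - 9 * B 1 * B 2 + 2 * B 3) * c 1 ^ 3) / 12"
    unfolding *(2) P by (simp add: power2_eq_square power3_eq_cube algebra_simps)
qed

text \<open>The equation \<open>z f' / f = p\<close> is solved by
  \<open>f z = z * exp (h z - h 0)\<close> with \<open>h\<close> a primitive of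
  \<open>(p z - 1) / z\<close>. Subtracting \<open>h 0\<close> normalizes \<open>deriv f 0\<close>
  to 1.\<close>

lemma exists_starlike_quotient_eq:
  assumes p: "p holomorphic_on unit_disc" and "p 0 = 1"
  obtains f where "f \<in> class_A" "\<And>z. z \<in> unit_disc \<Longrightarrow> starlike_quotient f z = p z"
proof -
  have "(\<lambda>z. p z - 1) holomorphic_on unit_disc"
    by (intro holomorphic_intros p)
  then obtain k where k: "k holomorphic_on unit_disc" "\<And>z. cmod z < 1 \<Longrightarrow> p z - 1 = z * k z"
    by (rule Schwarz3) (use assms(2) in auto)
  obtain h where h: "\<And>z. z \<in> unit_disc \<Longrightarrow> (h has_field_derivative k z) (at z within unit_disc)"
    using holomorphic_convex_primitive'[OF convex_ball open_ball k(1)] by blast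
  have h': "(h has_field_derivative k z) (at z)" if "z \<in> unit_disc" for z
    using h[OF that] at_within_open[OF that open_ball] by simp
  define f where "f = (\<lambda>z. z * exp (h z - h 0))"
  have df: "(f has_field_derivative exp (h z - h 0) * p z) (at z)" if "z \<in> unit_disc" for z
  proof -
    have "p z = 1 + z * k z"
      using k(2)[of z] that by (simp add: algebra_simps)
    then show ?thesis
      unfolding f_def using h'[OF that]
      by (auto intro!: derivative_eq_intros simp: algebra_simps)
  qed
  have "f holomorphic_on unit_disc"
    using df by (subst holomorphic_on_open) blast+
  moreover have "deriv f 0 = 1"
    using DERIV_imp_deriv[OF df[of 0]] assms(2) by simp
  ultimately have "f \<in> class_A"
    by (simp add: class_A_def f_def)
  moreover have "starlike_quotient f z = p z" if "z \<in> unit_disc" for z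
    using DERIV_imp_deriv[OF df[OF that]] assms(2)
    by (simp add: starlike_quotient_def f_def)
  ultimately show ?thesis
    using that by blast
qed

section \<open>The upper bound and the extremal function\<close>

theorem theorem4:
  fixes \<phi> :: "complex \<Rightarrow> complex" and B1 B2 B3 \<sigma>1 \<mu>1 :: real
  assumes "ma_minda \<phi>"
    and "B1 = mm_coeff \<phi> 1" and "B2 = mm_coeff \<phi> 2" and "B3 = mm_coeff \<phi> 3"
    and "\<sigma>1 = - ((9 * B1\<^sup>2 - 4 * B2) / (2 * B1))"
    and "\<mu>1 = (9 * B1^3 - 9 * B1 * B2 + 2 * B3) / (2 * B1)"
    and "\<bar>B2 - 2 * B1\<^sup>2\<bar> \<ge> B1"
    and "(\<sigma>1, \<mu>1) \<in> Omega1 \<union> Omega2 \<union> Omega3"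
  shows "(\<forall>f\<in>starlike_class \<phi>. cmod (toeplitz_log_inv_2_2 f) \<le>
            (B2 - 2 * B1\<^sup>2)\<^sup>2 / 16 + (9 * B1^3 - 9 * B1 * B2 + 2 * B3)\<^sup>2 / 144) \<and>
         (\<exists>f\<in>starlike_class \<phi>. cmod (toeplitz_log_inv_2_2 f) =
            (B2 - 2 * B1\<^sup>2)\<^sup>2 / 16 + (9 * B1^3 - 9 * B1 * B2 + 2 * B3)\<^sup>2 / 144)"
proof -
  define a m where "a = B2 - 2 * B1\<^sup>2" and "m = 9 * B1^3 - 9 * B1 * B2 + 2 * B3"
  have hol: "\<phi> holomorphic_on unit_disc" and \<phi>0: "\<phi> 0 = 1" and "Re (deriv \<phi> 0) > 0"
    using assms(1) by (auto simp: ma_minda_def)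
  then have B1: "B1 > 0"
    by (simp add: assms(2) mm_coeff_def taylor_coeff_def fps_expansion_def)
  have m: "m = 2 * B1 * \<mu>1" and s: "9 * B1\<^sup>2 - 4 * B2 = - (2 * B1 * \<sigma>1)"
    using B1 by (simp_all add: assms(5,6) m_def)
  have coeff2: "log_inv_coeff f 2 = - (B1 * taylor_coeff \<omega> 2 + a * (taylor_coeff \<omega> 1)\<^sup>2) / 4"
    and coeff3: "log_inv_coeff f 3 = - (B1 / 6) * (taylor_coeff \<omega> 3
        + \<sigma>1 * taylor_coeff \<omega> 1 * taylor_coeff \<omega> 2 + \<mu>1 * taylor_coeff \<omega> 1 ^ 3)"
    if "f \<in> class_A" "\<omega> holomorphic_on unit_disc" "\<omega> 0 = 0"
      "\<forall>z\<in>unit_disc. starlike_quotient f z = \<phi> (\<omega> z)" for f \<omega>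
  proof -
    note * = starlike_class_log_inv_coeff[OF assms(1) that, folded assms(2-4)]
    show "log_inv_coeff f 2 = - (B1 * taylor_coeff \<omega> 2 + a * (taylor_coeff \<omega> 1)\<^sup>2) / 4"
      using *(1) by (simp add: a_def)
    have sm: "9 * (of_real B1)\<^sup>2 - 4 * of_real B2 = complex_of_real (- (2 * B1 * \<sigma>1))"
      "9 * of_real B1 ^ 3 - 9 * of_real B1 * of_real B2 + 2 * of_real B3 = complex_of_real (2 * B1 * \<mu>1)"
      unfolding s[symmetric] m[symmetric] by (simp_all add: m_def)
    show "log_inv_coeff f 3 = - (B1 / 6) * (taylor_coeff \<omega> 3
        + \<sigma>1 * taylor_coeff \<omega> 1 * taylor_coeff \<omega> 2 + \<mu>1 * taylor_coeff \<omega> 1 ^ 3)"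
      using *(2) unfolding sm by (simp add: field_simps) algebra
  qed
  have "cmod (toeplitz_log_inv_2_2 f) \<le> a\<^sup>2 / 16 + m\<^sup>2 / 144" if f: "f \<in> starlike_class \<phi>" for f
  proof -
    obtain \<omega> where \<omega>: "\<omega> holomorphic_on unit_disc" "\<omega> 0 = 0"
        "\<And>z. z \<in> unit_disc \<Longrightarrow> cmod (\<omega> z) \<le> 1"
        "\<forall>z\<in>unit_disc. starlike_quotient f z = \<phi> (\<omega> z)"
      and fA: "f \<in> class_A"
      using f unfolding starlike_class_def subordinate_def by blast
    obtain c \<zeta> \<eta> :: complex where par: "cmod c \<le> 1" "cmod \<zeta> \<le> 1"
      and tc: "taylor_coeff \<omega> 1 = c" "taylor_coeff \<omega> 2 = (1 - (cmod c)\<^sup>2) * \<zeta>"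
      by (rule schwarz_coeff_parametrization[OF \<omega>(1-3)])
    have x: "(cmod c)\<^sup>2 \<le> 1"
      using par(1) by (simp add: power_le_one)
    have "cmod (B1 * taylor_coeff \<omega> 2 + a * (taylor_coeff \<omega> 1)\<^sup>2)
        \<le> B1 * ((1 - (cmod c)\<^sup>2) * cmod \<zeta>) + \<bar>a\<bar> * (cmod c)\<^sup>2"
      unfolding tc using x B1
      by (intro norm_triangle_mono) (simp_all only: norm_mult norm_of_real norm_power
        abs_of_nonneg diff_ge_0_iff_ge less_imp_le order_refl)
    \<comment> \<open>The hypothesis \<open>\<bar>B2 - 2 * B1\<^sup>2\<bar> \<ge> B1\<close>
      replaces \<open>B1\<close> by \<open>\<bar>a\<bar>\<close>; the two weights then add up to
      1.\<close>
    also have "\<dots> \<le> \<bar>a\<bar> * ((1 - (cmod c)\<^sup>2) * 1) + \<bar>a\<bar> * (cmod c)\<^sup>2"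
      using assms(7) par x B1 unfolding a_def[symmetric]
      by (intro add_mono mult_mono mult_nonneg_nonneg order_refl) auto
    finally have 2: "cmod (log_inv_coeff f 2) \<le> \<bar>a\<bar> / 4"
      unfolding coeff2[OF fA \<omega>(1,2,4)] norm_divide norm_minus_cancel
      by (simp add: algebra_simps)
    have "cmod (log_inv_coeff f 3) \<le> B1 / 6 * \<mu>1"
      unfolding coeff3[OF fA \<omega>(1,2,4)] norm_mult
      using prokhorov_szynal[OF \<omega>(1-3) assms(8)] B1 by (intro mult_mono) auto
    then have 3: "cmod (log_inv_coeff f 3) \<le> m / 12"
      by (simp add: m)
    have "cmod (toeplitz_log_inv_2_2 f) \<le> (cmod (log_inv_coeff f 2))\<^sup>2 + (cmod (log_inv_coeff f 3))\<^sup>2"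
      unfolding toeplitz_log_inv_2_2_def norm_power[symmetric] by (rule norm_triangle_ineq4)
    also have "\<dots> \<le> (\<bar>a\<bar> / 4)\<^sup>2 + (m / 12)\<^sup>2"
      by (intro add_mono power_mono 2 3) auto
    finally show ?thesis
      by (simp add: power_divide)
  qed
  moreover have "\<exists>f\<in>starlike_class \<phi>. cmod (toeplitz_log_inv_2_2 f) = a\<^sup>2 / 16 + m\<^sup>2 / 144"
  proof -
    define \<omega> where "\<omega> = (\<lambda>z. \<i> * z)"
    have \<omega>: "\<omega> holomorphic_on unit_disc" "\<omega> 0 = 0" "\<And>z. cmod (\<omega> z) = cmod z"
      unfolding \<omega>_def by (auto intro!: holomorphic_intros simp: norm_mult)
    have \<phi>\<omega>: "(\<lambda>z. \<phi> (\<omega> z)) holomorphic_on unit_disc"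
      using holomorphic_on_compose_gen[OF \<omega>(1) hol] \<omega>(3) by (simp add: o_def image_subset_iff)
    obtain f where f: "f \<in> class_A" "\<forall>z\<in>unit_disc. starlike_quotient f z = \<phi> (\<omega> z)"
    proof (rule exists_starlike_quotient_eq[OF \<phi>\<omega>])
      show "\<phi> (\<omega> 0) = 1"
        using \<omega>(2) \<phi>0 by simp
    qed blast
    \<comment> \<open>Subordination also demands holomorphy of the quotient, which it inherits from
      \<open>\<phi>\<close> composed with \<open>\<omega>\<close>.\<close>
    have "starlike_quotient f holomorphic_on unit_disc"
      using \<phi>\<omega> f(2) holomorphic_cong[of unit_disc unit_disc "starlike_quotient f"] by auto
    then have "f \<in> starlike_class \<phi>"
      unfolding starlike_class_def subordinate_def using f \<omega> hol
      by (auto intro!: exI[of _ \<omega>])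
    moreover have "fps_expansion \<omega> 0 = fps_const \<i> * fps_X"
      unfolding \<omega>_def by (intro fps_expansion_eqI fps_expansion_intros)
    then have tc: "taylor_coeff \<omega> 1 = \<i>" "taylor_coeff \<omega> 2 = 0" "taylor_coeff \<omega> 3 = 0"
      by (simp_all add: taylor_coeff_def)
    \<comment> \<open>Only \<open>c\<^sub>1 = \<i>\<close> is nonzero: its square -1 and its cube
      \<open>-\<i>\<close> cancel the minus signs of the coefficient formulas.\<close>
    have \<Gamma>: "log_inv_coeff f 2 = of_real (a / 4)" "log_inv_coeff f 3 = \<i> * of_real (m / 12)"
      unfolding coeff2[OF f(1) \<omega>(1,2) f(2)] coeff3[OF f(1) \<omega>(1,2) f(2)] tc
      by (simp_all add: m power3_eq_cube)
    have "toeplitz_log_inv_2_2 f = of_real (a\<^sup>2 / 16 + m\<^sup>2 / 144)"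
      unfolding toeplitz_log_inv_2_2_def \<Gamma> by (simp add: power_mult_distrib power_divide)
    then have "cmod (toeplitz_log_inv_2_2 f) = a\<^sup>2 / 16 + m\<^sup>2 / 144"
      by (simp only: norm_of_real) simp
    ultimately show ?thesis
      by blast
  qed
  ultimately show ?thesis
    unfolding a_def m_def by blast
qed

end
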